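(* Let $\ell\ge1$ and let $N_1,\dots,N_\ell$ be positive integers. The overall decoupling order $\check N_{\min}=\min_{\vec r_\ell\neq\vec 0_\ell}\check N_{\vec r_\ell}$ of the $\ell$-layer NUDD scheme with sequence order set $\{N_1,\dots,N_\ell\}$ is $$\check N_{\min}=\min_{i\in\{1,\dots,\ell\}}N_i .$$
   Context: The minimum defining $\check N_{\min}$ is over all nonzero vectors (nontrivial error types) $\vec r_\ell=(r_1,\dots,r_\ell)\in\{0,1\}^\ell$, and $\check N_{\vec r_\ell}$ is the decoupling order of the $\vec r_\ell$-type error for the $\ell$-layer nested Uhrig dynamical decoupling (NUDD) scheme, in which layer $i$ (layer 1 innermost) is a Uhrig sequence of order $N_i$. It is given by $$\check N_{\vec r_\ell}=\max_{i\in\{1,\dots,\ell\}}\Big[r_i\,\big(p_\oplus(1,i-1)\oplus 1\big)\,\widetilde N_i+p_+(i+1,\ell)\Big].$$ Here $[x]_2\in\{0,1\}$ is $x$ mod $2$, $\oplus$ is addition mod 2 (its value in $\{0,1\}$ being used as an integer), and $$p_\oplus(a,b)=\bigoplus_{k=a}^b r_k[N_k]_2,\qquad p_+(a,b)=\sum_{k=a}^b r_k[N_k]_2\ (\text{integer sum}),$$ if $b\ge a$, and both are $0$ if $b<a$. Let $o_1$ be the smallest index $i$ with $N_i$ odd (if all $N_i$ are even, $i\le o_1$ is regarded as true for all $i$). Then $$\widetilde N_i=\begin{cases}N_i & i\le o_1,\\ \min[N^{k'<i}_{o_{\min}}+1,\;N_i] & i>o_1,\end{cases}\qquad N^{k'<i}_{o_{\min}}=\min\{N_{k'}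 : k'<i,\ [N_{k'}]_2=1\}.$$ *)

theory Defs
  imports Main "HOL-Library.FuncSet"
begin

text \<open>
  The order of the Uhrig sequence in layer \<open>i \<in> {1..l}\<close> of an \<open>l\<close>-layer nested scheme is \<open>N i\<close>,
  with layer 1 innermost. Values of \<open>N\<close> outside \<open>{1..l}\<close> are irrelevant.
\<close>

text \<open>Binary vectors with entries \<open>1, ..., l\<close>; extensionality makes this a finite set.\<close>

definition error_types :: "nat \<Rightarrow> (nat \<Rightarrow> nat) set" where
  "error_types l = {1..l} \<rightarrow>\<^sub>E {0, 1}"

definition nontrivial_error_types :: "nat \<Rightarrow> (nat \<Rightarrow> nat) set" where
  "nontrivial_error_types l = {r \<in> error_types l. \<exists>i\<in>{1..l}. r i \<noteq> 0}"

definition xor2 :: "nat \<Rightarrow> nat \<Rightarrow> nat" where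
  "xor2 x y = (x + y) mod 2"

text \<open>In both sums below, \<open>{a..b}\<close> is empty, and hence the value is 0, if \<open>b < a\<close>.\<close>

definition p_xor :: "(nat \<Rightarrow> nat) \<Rightarrow> (nat \<Rightarrow> nat) \<Rightarrow> nat \<Rightarrow> nat \<Rightarrow> nat" where
  "p_xor N r a b = (\<Sum>k=a..b. r k * (N k mod 2)) mod 2"

definition p_plus :: "(nat \<Rightarrow> nat) \<Rightarrow> (nat \<Rightarrow> nat) \<Rightarrow> nat \<Rightarrow> nat \<Rightarrow> nat" where
  "p_plus N r a b = (\<Sum>k=a..b. r k * (N k mod 2))"

definition first_odd :: "nat \<Rightarrow> (nat \<Rightarrow> nat) \<Rightarrow> nat" where
  "first_odd l N = (LEAST i. i \<in> {1..l} \<and> odd (N i))"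

text \<open>The relation \<open>i \<le> o\<^sub>1\<close>, which holds for every \<open>i\<close> if all orders are even.\<close>

definition upto_first_odd :: "nat \<Rightarrow> (nat \<Rightarrow> nat) \<Rightarrow> nat \<Rightarrow> bool" where
  "upto_first_odd l N i \<longleftrightarrow> (\<forall>k\<in>{1..l}. even (N k)) \<or> i \<le> first_odd l N"

definition min_odd_below :: "(nat \<Rightarrow> nat) \<Rightarrow> nat \<Rightarrow> nat" where
  "min_odd_below N i = Min (N ` {k \<in> {1..<i}. odd (N k)})"

definition N_tilde :: "nat \<Rightarrow> (nat \<Rightarrow> nat) \<Rightarrow> nat \<Rightarrow> nat" where
  "N_tilde l N i =
     (if upto_first_odd l N i then N i else min (min_odd_below N i + 1) (N i))"

text \<open>The decoupling order of the error of type \<open>r\<close>, given by its closed formula.\<close>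

definition decoupling_order :: "nat \<Rightarrow> (nat \<Rightarrow> nat) \<Rightarrow> (nat \<Rightarrow> nat) \<Rightarrow> nat" where
  "decoupling_order l N r =
     Max ((\<lambda>i. r i * xor2 (p_xor N r 1 (i - 1)) 1 * N_tilde l N i + p_plus N r (i + 1) l) ` {1..l})"

definition overall_decoupling_order :: "nat \<Rightarrow> (nat \<Rightarrow> nat) \<Rightarrow> nat" where
  "overall_decoupling_order l N = Min (decoupling_order l N ` nontrivial_error_types l)"

end

theory Submission
  imports Defs
begin

text \<open>
  At the innermost layer on which an error acts, the parity factor is 1, so the corresponding
  term is at least \<open>N_tilde\<close>, which never drops below the minimal order. Conversely, the error
  acting only on a layer of minimal order attains the bound.
\<close>

text \<open>Both branches of \<open>N_tilde\<close> are built from orders of actual layers, and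
  adding 1 or taking the minimum with \<open>N i\<close> cannot take them below the smallest
  order.\<close>

lemma Min_le_N_tilde:
  assumes i: "i \<in> {1..l}"
  shows "Min (N ` {1..l}) \<le> N_tilde l N i"
proof (cases "upto_first_odd l N i")
  case True
  then show ?thesis using i by (simp add: N_tilde_def)
next
  case False
  let ?S = "{k \<in> {1..<i}. odd (N k)}"
  obtain k where "k \<in> {1..l} \<and> odd (N k)"
    using False by (auto simp: upto_first_odd_def)
  then have "first_odd l N \<in> {1..l} \<and> odd (N (first_odd l N))"
    unfolding first_odd_def by (rule LeastI)
  \<comment> \<open>The failure of \<open>upto_first_odd\<close> puts the first odd layer strictly
    below \<open>i\<close>. So \<open>?S\<close> is nonempty and \<open>min_odd_below\<close> is a
    genuine order, not the unspecified minimum of an empty set.\<close>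
  then have "first_odd l N \<in> ?S"
    using False by (auto simp: upto_first_odd_def)
  then have "min_odd_below N i \<in> N ` ?S"
    unfolding min_odd_below_def by (intro Min_in) auto
  also have "N ` ?S \<subseteq> N ` {1..l}" using i by auto
  finally have "Min (N ` {1..l}) \<le> min_odd_below N i" by simp
  then show ?thesis using i False by (simp add: N_tilde_def)
qed

lemma N_tilde_le: "N_tilde l N i \<le> N i"
  by (simp add: N_tilde_def)

lemma finite_nontrivial_error_types: "finite (nontrivial_error_types l)"
  unfolding nontrivial_error_types_def error_types_def
  by (intro finite_subset[OF _ finite_PiE[of "{1..l}" "\<lambda>_. {0, 1}"]]) auto

lemma Min_le_decoupling_order:
  assumes r: "r \<in> nontrivial_error_types l"
  shows "Min (N ` {1..l}) \<le> decoupling_order l N r"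
proof -
  let ?Q = "\<lambda>i. i \<in> {1..l} \<and> r i \<noteq> 0"
  let ?t = "\<lambda>i. r i * xor2 (p_xor N r 1 (i - 1)) 1 * N_tilde l N i + p_plus N r (i + 1) l"
  define i where "i = (LEAST i. ?Q i)"
  obtain j where "?Q j"
    using r by (auto simp: nontrivial_error_types_def)
  then have i: "?Q i"
    unfolding i_def by (rule LeastI)
  have "r i = 1"
    using r i by (force simp: nontrivial_error_types_def error_types_def PiE_iff)
  \<comment> \<open>Leastness of \<open>i\<close> makes the error vanish on all layers inside it;
    for \<open>i = 1\<close> the range is empty.\<close>
  have "r k = 0" if "k \<in> {1..i - 1}" for k
    using that i not_less_Least[of k ?Q, folded i_def] by auto
  then have "p_xor N r 1 (i - 1) = 0"
    by (simp add: p_xor_def)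
  \<comment> \<open>The parity factor is \<open>xor2 0 1 = 1\<close>, and the summand
    \<open>p_plus\<close> can only increase the term.\<close>
  with \<open>r i = 1\<close> have "N_tilde l N i \<le> ?t i"
    by (simp add: xor2_def)
  also have "?t i \<le> decoupling_order l N r"
    unfolding decoupling_order_def using i by (intro Max_ge) auto
  finally show ?thesis
    using Min_le_N_tilde[of i l N] i by simp
qed

text \<open>\<open>restrict\<close> makes the vector extensional, as membership in
  \<open>error_types\<close> demands.\<close>

definition single_error :: "nat \<Rightarrow> nat \<Rightarrow> nat \<Rightarrow> nat" where
  "single_error l j = restrict (\<lambda>i. if i = j then 1 else 0) {1..l}"

lemma single_error_nontrivial:
  "j \<in> {1..l} \<Longrightarrow> single_error l j \<in> nontrivial_error_types l"
  by (auto simp: single_error_def nontrivial_error_types_def error_types_def)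

text \<open>The bounds keep the summation inside \<open>{1..l}\<close>, away from the
  \<open>undefined\<close> entries of the vector.\<close>

lemma p_plus_single_error:
  assumes "1 \<le> a" and "b \<le> l"
  shows "p_plus N (single_error l j) a b = (if j \<in> {a..b} then N j mod 2 else 0)"
proof -
  have "p_plus N (single_error l j) a b = (\<Sum>k=a..b. if k = j then N k mod 2 else 0)"
    unfolding p_plus_def single_error_def using assms by (intro sum.cong) auto
  then show ?thesis by simp
qed

lemma decoupling_order_single_error_le:
  assumes j: "j \<in> {1..l}"
  shows "decoupling_order l N (single_error l j) \<le> N j"
proof -
  let ?r = "single_error l j"
  have "?r i * xor2 (p_xor N ?r 1 (i - 1)) 1 * N_tilde l N i + p_plus N ?r (i + 1) l \<le> N j"
    if i: "i \<in> {1..l}" for i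
  proof (cases "i = j")
    case True
    have "xor2 (p_xor N ?r 1 (j - 1)) 1 * N_tilde l N j \<le> 1 * N j"
      by (intro mult_le_mono N_tilde_le) (simp add: xor2_def)
    moreover have "?r j = 1" using j by (simp add: single_error_def)
    \<comment> \<open>The tail sum starts at \<open>j + 1\<close>, past the only nonzero entry, and
      so adds nothing.\<close>
    ultimately show ?thesis
      using True by (simp add: p_plus_single_error)
  next
    case False
    then have "?r i = 0" using i by (simp add: single_error_def)
    \<comment> \<open>Only the tail sum survives: it is \<open>N j mod 2\<close> for
      \<open>i < j\<close> and 0 for \<open>i > j\<close>.\<close>
    moreover have "N j mod 2 \<le> N j" by (rule mod_less_eq_dividend)
    ultimately show ?thesis by (simp add: p_plus_single_error)
  qed
  then show ?thesis
    unfolding decoupling_order_def using j by (subst Max_le_iff) auto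
qed

theorem corollary1:
  fixes l :: nat and N :: "nat \<Rightarrow> nat"
  assumes "l \<ge> 1"
    and "\<And>i. i \<in> {1..l} \<Longrightarrow> N i > 0"
  shows "overall_decoupling_order l N = Min (N ` {1..l})"
proof -
  let ?D = "decoupling_order l N ` nontrivial_error_types l"
  have fin: "finite ?D"
    by (simp add: finite_nontrivial_error_types)
  have "Min (N ` {1..l}) \<in> N ` {1..l}"
    using assms(1) by (intro Min_in) auto
  then obtain j where j: "j \<in> {1..l}" "N j = Min (N ` {1..l})"
    by auto
  have mem: "decoupling_order l N (single_error l j) \<in> ?D"
    using single_error_nontrivial[OF j(1)] by simp
  have "Min ?D \<le> N j"
    using Min_le[OF fin mem] decoupling_order_single_error_le[of j l N] j(1) by force
  moreover have "Min (N ` {1..l}) \<le> Min ?D"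
    using fin mem Min_le_decoupling_order by (subst Min_ge_iff) blast+
  ultimately show ?thesis
    using j(2) by (simp add: overall_decoupling_order_def)
qed

end
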